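(* Let $\mathcal{A},\mathcal{B}$ be sets of $\tau$-structures and $r,k\in\mathbb{N}$. Spoiler has a winning strategy in the $(r,k)$-quantifier-variable tree game on $(\mathcal{A},\mathcal{B})$ if and only if there is a first-order sentence over $\tau$ with $r$ quantifiers and $k$ variables that is separating for $(\mathcal{A},\mathcal{B})$.
   Context: A sentence with $k$ variables uses only the variables $x_1,\dots,x_k$ (possibly re-quantified); a separating sentence for $(\mathcal{A},\mathcal{B})$ is true on every structure in $\mathcal{A}$ and false on every structure in $\mathcal{B}$. The $(r,k)$-QVT game on $(\mathcal{A},\mathcal{B})$ uses pebble colors $x_1,\dots,x_k$ (arbitrarily many pebbles of each). Spoiler and Duplicator grow a game tree $\mathcal{T}$ whose nodes are triples $(\text{left},\text{right},r')$ where left and right are sets of pebbled $\tau$-structures (structures with some elements carrying pebbles, at most one pebble of each color per structure) and $r'\in\mathbb{N}$ is a counter; within every node, a color is present on one structure iff it is present on all. The root is $(\mathcal{A},\mathcal{B},r)$ with no pebbles, an open leaf. On his turn Spoiler picks an open leaf $X=(\mathcal{A}',\mathcal{B}',r')$ and does one of: (Pebble-Left, only if $r'\ge1$) choose a color $x_i$; if $x_i$ is present in $X$ remove all pebbles of color $x_i$; Spoiler places a pebble $x_i$ on an element of each structure of $\mathcal{A}'$, giving $\mathcal{A}''$; Duplicator, for each structure of $\mathcal{B}'$, may make any number of copies and places a pebble $x_i$ on an element of each copy, giving $\mathcal{B}''$; new child $(\mathcal{A}'',\mathcal{B}'',r'-1)$. (Pebble-Right) dual, with Spoiler on the right and Duplicator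 on the left. (Split-Left) choose $r'_1+r'_2=r'$ and a partition $\mathcal{A}'=\mathcal{A}'_1\cup\mathcal{A}'_2$, creating children $(\mathcal{A}'_1,\mathcal{B}',r'_1)$ and $(\mathcal{A}'_2,\mathcal{B}',r'_2)$. (Split-Right) dual, partitioning $\mathcal{B}'$. (Swap) create child $(\mathcal{B}',\mathcal{A}',r')$. (Close) if there is an atomic formula $\varphi$ with variables $x_{i_1},\dots,x_{i_m}\in\{x_1,\dots,x_k\}$ such that every structure in $\mathcal{A}'$ carries pebbles of colors $x_{i_1},\dots,x_{i_m}$ and satisfies $\varphi$ when each $x_{i_j}$ is interpreted as the element with pebble $x_{i_j}$, and every structure in $\mathcal{B}'$ carries these pebbles and satisfies $\neg\varphi$ under the same interpretation, mark $X$ closed. Spoiler wins if all leaves of $\mathcal{T}$ become closed; otherwise Duplicator wins.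
   Formalization: "With r quantifiers" is read as at most r (equivalent to exactly r when k ≥ 1; the exact reading fails for k = 0 < r), and the constant "true" is counted as an atomic formula in the logic and in the Close move, since otherwise the claim fails when both sets are empty and r = 0. *)

theory Defs
  imports Main
begin

text \<open>Vocabularies may contain function symbols; constants are the nullary ones, and a symbol
  belongs to the vocabulary iff it has an arity.\<close>

record ('f, 'r) vocab =
  farity :: "'f \<rightharpoonup> nat"
  rarity :: "'r \<rightharpoonup> nat"

record ('f, 'r, 'a) struct =
  univ :: "'a set"
  fint :: "'f \<Rightarrow> 'a list \<Rightarrow> 'a"
  rint :: "'r \<Rightarrow> 'a list set"

definition is_struct :: "('f, 'r) vocab \<Rightarrow> ('f, 'r, 'a) struct \<Rightarrow> bool" where
  "is_struct \<tau> S \<longleftrightarrow>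
     univ S \<noteq> {} \<and>
     (\<forall>f n as. farity \<tau> f = Some n \<and> length as = n \<and> set as \<subseteq> univ S \<longrightarrow> fint S f as \<in> univ S) \<and>
     (\<forall>R n. rarity \<tau> R = Some n \<longrightarrow> rint S R \<subseteq> {as. length as = n \<and> set as \<subseteq> univ S})"

datatype 'f tm = Var nat | App 'f "'f tm list"

text \<open>The variable-free atomic formula \<open>Tru\<close> is needed for degenerate instances only: it can matter
  only if one of the two sets of structures is empty. If both are empty, then a leaf can be closed
  with \<open>x\<^sub>1 = x\<^sub>1\<close> vacuously, whereas a constant-free vocabulary without nullary
  relations has no quantifier-free sentence other than those built from \<open>Tru\<close>.\<close>

datatype ('f, 'r) atom = Tru | Eq "'f tm" "'f tm" | Rel 'r "'f tm list"

datatype ('f, 'r) fm =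
    Atom "('f, 'r) atom"
  | Neg "('f, 'r) fm"
  | And "('f, 'r) fm" "('f, 'r) fm"
  | Or "('f, 'r) fm" "('f, 'r) fm"
  | Ex nat "('f, 'r) fm"
  | All nat "('f, 'r) fm"

fun tm_ok :: "('f, 'r) vocab \<Rightarrow> 'f tm \<Rightarrow> bool" where
  "tm_ok \<tau> (Var i) \<longleftrightarrow> True"
| "tm_ok \<tau> (App f ts) \<longleftrightarrow> farity \<tau> f = Some (length ts) \<and> (\<forall>t\<in>set ts. tm_ok \<tau> t)"

fun atom_ok :: "('f, 'r) vocab \<Rightarrow> ('f, 'r) atom \<Rightarrow> bool" where
  "atom_ok \<tau> Tru \<longleftrightarrow> True"
| "atom_ok \<tau> (Eq s t) \<longleftrightarrow> tm_ok \<tau> s \<and> tm_ok \<tau> t"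
| "atom_ok \<tau> (Rel R ts) \<longleftrightarrow> rarity \<tau> R = Some (length ts) \<and> (\<forall>t\<in>set ts. tm_ok \<tau> t)"

fun fm_ok :: "('f, 'r) vocab \<Rightarrow> ('f, 'r) fm \<Rightarrow> bool" where
  "fm_ok \<tau> (Atom a) \<longleftrightarrow> atom_ok \<tau> a"
| "fm_ok \<tau> (Neg \<phi>) \<longleftrightarrow> fm_ok \<tau> \<phi>"
| "fm_ok \<tau> (And \<phi> \<psi>) \<longleftrightarrow> fm_ok \<tau> \<phi> \<and> fm_ok \<tau> \<psi>"
| "fm_ok \<tau> (Or \<phi> \<psi>) \<longleftrightarrow> fm_ok \<tau> \<phi> \<and> fm_ok \<tau> \<psi>"
| "fm_ok \<tau> (Ex i \<phi>) \<longleftrightarrow> fm_ok \<tau> \<phi>"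
| "fm_ok \<tau> (All i \<phi>) \<longleftrightarrow> fm_ok \<tau> \<phi>"

fun tm_vars :: "'f tm \<Rightarrow> nat set" where
  "tm_vars (Var i) = {i}"
| "tm_vars (App f ts) = (\<Union>t\<in>set ts. tm_vars t)"

fun atom_vars :: "('f, 'r) atom \<Rightarrow> nat set" where
  "atom_vars Tru = {}"
| "atom_vars (Eq s t) = tm_vars s \<union> tm_vars t"
| "atom_vars (Rel R ts) = (\<Union>t\<in>set ts. tm_vars t)"

fun free_vars :: "('f, 'r) fm \<Rightarrow> nat set" where
  "free_vars (Atom a) = atom_vars a"
| "free_vars (Neg \<phi>) = free_vars \<phi>"
| "free_vars (And \<phi> \<psi>) = free_vars \<phi> \<union> free_vars \<psi>"
| "free_vars (Or \<phi> \<psi>) = free_vars \<phi> \<union> free_vars \<psi>"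
| "free_vars (Ex i \<phi>) = free_vars \<phi> - {i}"
| "free_vars (All i \<phi>) = free_vars \<phi> - {i}"

fun all_vars :: "('f, 'r) fm \<Rightarrow> nat set" where
  "all_vars (Atom a) = atom_vars a"
| "all_vars (Neg \<phi>) = all_vars \<phi>"
| "all_vars (And \<phi> \<psi>) = all_vars \<phi> \<union> all_vars \<psi>"
| "all_vars (Or \<phi> \<psi>) = all_vars \<phi> \<union> all_vars \<psi>"
| "all_vars (Ex i \<phi>) = insert i (all_vars \<phi>)"
| "all_vars (All i \<phi>) = insert i (all_vars \<phi>)"

fun num_quants :: "('f, 'r) fm \<Rightarrow> nat" where
  "num_quants (Atom a) = 0"
| "num_quants (Neg \<phi>) = num_quants \<phi>"
| "num_quants (And \<phi> \<psi>) = num_quants \<phi> + num_quants \<psi>"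
| "num_quants (Or \<phi> \<psi>) = num_quants \<phi> + num_quants \<psi>"
| "num_quants (Ex i \<phi>) = Suc (num_quants \<phi>)"
| "num_quants (All i \<phi>) = Suc (num_quants \<phi>)"

fun tm_val :: "('f, 'r, 'a) struct \<Rightarrow> (nat \<Rightarrow> 'a) \<Rightarrow> 'f tm \<Rightarrow> 'a" where
  "tm_val S e (Var i) = e i"
| "tm_val S e (App f ts) = fint S f (map (tm_val S e) ts)"

fun atom_sat :: "('f, 'r, 'a) struct \<Rightarrow> (nat \<Rightarrow> 'a) \<Rightarrow> ('f, 'r) atom \<Rightarrow> bool" where
  "atom_sat S e Tru \<longleftrightarrow> True"
| "atom_sat S e (Eq s t) \<longleftrightarrow> tm_val S e s = tm_val S e t"
| "atom_sat S e (Rel R ts) \<longleftrightarrow> map (tm_val S e) ts \<in> rint S R"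

fun sat :: "('f, 'r, 'a) struct \<Rightarrow> (nat \<Rightarrow> 'a) \<Rightarrow> ('f, 'r) fm \<Rightarrow> bool" where
  "sat S e (Atom a) \<longleftrightarrow> atom_sat S e a"
| "sat S e (Neg \<phi>) \<longleftrightarrow> \<not> sat S e \<phi>"
| "sat S e (And \<phi> \<psi>) \<longleftrightarrow> sat S e \<phi> \<and> sat S e \<psi>"
| "sat S e (Or \<phi> \<psi>) \<longleftrightarrow> sat S e \<phi> \<or> sat S e \<psi>"
| "sat S e (Ex i \<phi>) \<longleftrightarrow> (\<exists>a\<in>univ S. sat S (e(i := a)) \<phi>)"
| "sat S e (All i \<phi>) \<longleftrightarrow> (\<forall>a\<in>univ S. sat S (e(i := a)) \<phi>)"

text \<open>A sentence over \<open>\<tau>\<close> with \<open>k\<close> variables: every variable occurring in it, free, bound or merely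
  quantified, is among \<open>x\<^sub>1, \<dots>, x\<^sub>k\<close>.\<close>

definition is_sentence :: "('f, 'r) vocab \<Rightarrow> nat \<Rightarrow> ('f, 'r) fm \<Rightarrow> bool" where
  "is_sentence \<tau> k \<phi> \<longleftrightarrow> fm_ok \<tau> \<phi> \<and> free_vars \<phi> = {} \<and> all_vars \<phi> \<subseteq> {1..k}"

definition models :: "('f, 'r, 'a) struct \<Rightarrow> ('f, 'r) fm \<Rightarrow> bool" where
  "models S \<phi> \<longleftrightarrow> (\<forall>e. range e \<subseteq> univ S \<longrightarrow> sat S e \<phi>)"

definition separating ::
  "('f, 'r, 'a) struct set \<Rightarrow> ('f, 'r, 'a) struct set \<Rightarrow> ('f, 'r) fm \<Rightarrow> bool" where
  "separating \<A> \<B> \<phi> \<longleftrightarrow> (\<forall>S\<in>\<A>. models S \<phi>) \<and> (\<forall>S\<in>\<B>. \<not> models S \<phi>)"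


text \<open>The second component maps each colour present on the structure to the element carrying the
  pebble of that colour.\<close>

type_synonym ('f, 'r, 'a) pebbled = "('f, 'r, 'a) struct \<times> (nat \<rightharpoonup> 'a)"

type_synonym ('f, 'r, 'a) gnode =
  "('f, 'r, 'a) pebbled set \<times> ('f, 'r, 'a) pebbled set \<times> nat"

datatype 'n gtree = Open 'n | Closed 'n | Branch 'n "'n gtree list"

datatype ('f, 'r, 'a) act =
    PebbleLeft nat "('f, 'r, 'a) pebbled \<Rightarrow> 'a"
  | PebbleRight nat "('f, 'r, 'a) pebbled \<Rightarrow> 'a"
  | SplitLeft nat nat "('f, 'r, 'a) pebbled set" "('f, 'r, 'a) pebbled set"
  | SplitRight nat nat "('f, 'r, 'a) pebbled set" "('f, 'r, 'a) pebbled set"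
  | Swap
  | Close "('f, 'r) atom"

text \<open>Updating the partial map also removes a pebble of colour \<open>i\<close> already present.\<close>

definition place :: "nat \<Rightarrow> 'a \<Rightarrow> ('f, 'r, 'a) pebbled \<Rightarrow> ('f, 'r, 'a) pebbled" where
  "place i a P = (fst P, (snd P)(i \<mapsto> a))"

definition place_each ::
  "nat \<Rightarrow> (('f, 'r, 'a) pebbled \<Rightarrow> 'a) \<Rightarrow> ('f, 'r, 'a) pebbled set \<Rightarrow> ('f, 'r, 'a) pebbled set" where
  "place_each i f L = (\<lambda>P. place i (f P) P) ` L"

text \<open>All possible replies of Duplicator on the side \<open>L\<close>: \<open>D P\<close> is the set of elements pebbled on
  the copies of \<open>P\<close>; each structure is kept in at least one copy, and possibly in infinitely many.\<close>

definition dup_replies ::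
  "nat \<Rightarrow> ('f, 'r, 'a) pebbled set \<Rightarrow> ('f, 'r, 'a) pebbled set set" where
  "dup_replies i L =
     {\<Union>P\<in>L. (\<lambda>a. place i a P) ` D P | D. \<forall>P\<in>L. D P \<noteq> {} \<and> D P \<subseteq> univ (fst P)}"

definition peb_sat :: "('f, 'r, 'a) pebbled \<Rightarrow> ('f, 'r) atom \<Rightarrow> bool" where
  "peb_sat P a \<longleftrightarrow> atom_sat (fst P) (\<lambda>i. the (snd P i)) a"

fun legal :: "('f, 'r) vocab \<Rightarrow> nat \<Rightarrow> ('f, 'r, 'a) gnode \<Rightarrow> ('f, 'r, 'a) act \<Rightarrow> bool" where
  "legal \<tau> k (L, R, r) (PebbleLeft i f) \<longleftrightarrow>
     1 \<le> r \<and> i \<in> {1..k} \<and> (\<forall>P\<in>L. f P \<in> univ (fst P))"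
| "legal \<tau> k (L, R, r) (PebbleRight i f) \<longleftrightarrow>
     1 \<le> r \<and> i \<in> {1..k} \<and> (\<forall>P\<in>R. f P \<in> univ (fst P))"
| "legal \<tau> k (L, R, r) (SplitLeft r1 r2 L1 L2) \<longleftrightarrow>
     r1 + r2 = r \<and> L1 \<union> L2 = L \<and> L1 \<inter> L2 = {}"
| "legal \<tau> k (L, R, r) (SplitRight r1 r2 R1 R2) \<longleftrightarrow>
     r1 + r2 = r \<and> R1 \<union> R2 = R \<and> R1 \<inter> R2 = {}"
| "legal \<tau> k (L, R, r) Swap \<longleftrightarrow> True"
| "legal \<tau> k (L, R, r) (Close a) \<longleftrightarrow>
     atom_ok \<tau> a \<and> atom_vars a \<subseteq> {1..k} \<and>
     (\<forall>P\<in>L. atom_vars a \<subseteq> dom (snd P) \<and> peb_sat P a) \<and>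
     (\<forall>P\<in>R. atom_vars a \<subseteq> dom (snd P) \<and> \<not> peb_sat P a)"

text \<open>The trees that may replace the chosen open leaf, one for each reply of Duplicator.\<close>

fun results :: "('f, 'r, 'a) gnode \<Rightarrow> ('f, 'r, 'a) act \<Rightarrow> ('f, 'r, 'a) gnode gtree set" where
  "results (L, R, r) (PebbleLeft i f) =
     {Branch (L, R, r) [Open (place_each i f L, R', r - 1)] | R'. R' \<in> dup_replies i R}"
| "results (L, R, r) (PebbleRight i f) =
     {Branch (L, R, r) [Open (L', place_each i f R, r - 1)] | L'. L' \<in> dup_replies i L}"
| "results (L, R, r) (SplitLeft r1 r2 L1 L2) =
     {Branch (L, R, r) [Open (L1, R, r1), Open (L2, R, r2)]}"
| "results (L, R, r) (SplitRight r1 r2 R1 R2) =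
     {Branch (L, R, r) [Open (L, R1, r1), Open (L, R2, r2)]}"
| "results (L, R, r) Swap = {Branch (L, R, r) [Open (R, L, r)]}"
| "results (L, R, r) (Close a) = {Closed (L, R, r)}"

fun all_closed :: "'n gtree \<Rightarrow> bool" where
  "all_closed (Open X) \<longleftrightarrow> False"
| "all_closed (Closed X) \<longleftrightarrow> True"
| "all_closed (Branch X ts) \<longleftrightarrow> (\<forall>t\<in>set ts. all_closed t)"

text \<open>Positions in a tree are addressed by the list of child indices leading to them.\<close>

fun open_leaf :: "'n gtree \<Rightarrow> nat list \<Rightarrow> 'n option" where
  "open_leaf (Open X) [] = Some X"
| "open_leaf (Branch X ts) (i # p) = (if i < length ts then open_leaf (ts ! i) p else None)"
| "open_leaf _ _ = None"

fun graft :: "'n gtree \<Rightarrow> nat list \<Rightarrow> 'n gtree \<Rightarrow> 'n gtree" where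
  "graft T [] U = U"
| "graft (Branch X ts) (i # p) U =
     (if i < length ts then Branch X (ts[i := graft (ts ! i) p U]) else Branch X ts)"
| "graft T (i # p) U = T"

text \<open>The possible trees after Spoiler plays \<open>a\<close> at the leaf with address \<open>p\<close>. Proposing an illegal
  move leaves the tree unchanged, so a strategy that does so never gets any further.\<close>

definition successors ::
  "('f, 'r) vocab \<Rightarrow> nat \<Rightarrow> ('f, 'r, 'a) gnode gtree \<Rightarrow> nat list \<times> ('f, 'r, 'a) act \<Rightarrow>
   ('f, 'r, 'a) gnode gtree set" where
  "successors \<tau> k T = (\<lambda>(p, a).
     (case open_leaf T p of
        None \<Rightarrow> {T}
      | Some X \<Rightarrow> if legal \<tau> k X a then graft T p ` results X a else {T}))"

text \<open>A strategy maps the current game tree, which retains all earlier nodes, to a leaf and an action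
  there. Spoiler wins a play if all leaves are closed after finitely many moves; such a tree has no
  open leaf and hence no longer changes.\<close>

type_synonym ('f, 'r, 'a) strategy =
  "('f, 'r, 'a) gnode gtree \<Rightarrow> nat list \<times> ('f, 'r, 'a) act"

definition consistent_play ::
  "('f, 'r) vocab \<Rightarrow> nat \<Rightarrow> ('f, 'r, 'a) gnode gtree \<Rightarrow> ('f, 'r, 'a) strategy \<Rightarrow>
   (nat \<Rightarrow> ('f, 'r, 'a) gnode gtree) \<Rightarrow> bool" where
  "consistent_play \<tau> k T0 \<sigma> \<rho> \<longleftrightarrow>
     \<rho> 0 = T0 \<and> (\<forall>n. \<rho> (Suc n) \<in> successors \<tau> k (\<rho> n) (\<sigma> (\<rho> n)))"

definition winning_strategy ::
  "('f, 'r) vocab \<Rightarrow> nat \<Rightarrow> ('f, 'r, 'a) gnode gtree \<Rightarrow> ('f, 'r, 'a) strategy \<Rightarrow> bool" where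
  "winning_strategy \<tau> k T0 \<sigma> \<longleftrightarrow>
     (\<forall>\<rho>. consistent_play \<tau> k T0 \<sigma> \<rho> \<longrightarrow> (\<exists>n. all_closed (\<rho> n)))"

definition unpebbled :: "('f, 'r, 'a) struct \<Rightarrow> ('f, 'r, 'a) pebbled" where
  "unpebbled S = (S, Map.empty)"

definition spoiler_wins_QVT ::
  "('f, 'r) vocab \<Rightarrow> nat \<Rightarrow> nat \<Rightarrow> ('f, 'r, 'a) struct set \<Rightarrow> ('f, 'r, 'a) struct set \<Rightarrow> bool" where
  "spoiler_wins_QVT \<tau> r k \<A> \<B> \<longleftrightarrow>
     (\<exists>\<sigma>. winning_strategy \<tau> k (Open (unpebbled ` \<A>, unpebbled ` \<B>, r)) \<sigma>)"


lemma tm_val_cong: "(\<And>i. i \<in> tm_vars t \<Longrightarrow> e i = e' i) \<Longrightarrow> tm_val S e t = tm_val S e' t"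
proof (induction t)
  case (App f ts)
  then have "map (tm_val S e) ts = map (tm_val S e') ts" by auto
  then show ?case by (simp only: tm_val.simps)
qed simp

lemma atom_sat_cong:
  assumes "\<And>i. i \<in> atom_vars a \<Longrightarrow> e i = e' i"
  shows "atom_sat S e a \<longleftrightarrow> atom_sat S e' a"
proof (cases a)
  case (Eq s t)
  then have "tm_val S e s = tm_val S e' s" "tm_val S e t = tm_val S e' t"
    using assms by (auto intro!: tm_val_cong)
  with Eq show ?thesis by simp
next
  case (Rel R ts)
  then have "map (tm_val S e) ts = map (tm_val S e') ts"
    using assms by (auto intro!: tm_val_cong)
  with Rel show ?thesis by (simp only: atom_sat.simps)
qed simp

lemma sat_cong: "(\<And>i. i \<in> free_vars \<phi> \<Longrightarrow> e i = e' i) \<Longrightarrow> sat S e \<phi> \<longleftrightarrow> sat S e' \<phi>"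
proof (induction \<phi> arbitrary: e e')
  case (Atom a)
  have "atom_sat S e a = atom_sat S e' a" by (intro atom_sat_cong) (use Atom.prems in simp)
  then show ?case by simp
next
  case (Neg \<phi>)
  have "sat S e \<phi> = sat S e' \<phi>" by (intro Neg.IH) (use Neg.prems in simp)
  then show ?case by simp
next
  case (And \<phi> \<psi>)
  have "sat S e \<phi> = sat S e' \<phi>" by (intro And.IH) (use And.prems in simp)
  moreover have "sat S e \<psi> = sat S e' \<psi>" by (intro And.IH) (use And.prems in simp)
  ultimately show ?case by simp
next
  case (Or \<phi> \<psi>)
  have "sat S e \<phi> = sat S e' \<phi>" by (intro Or.IH) (use Or.prems in simp)
  moreover have "sat S e \<psi> = sat S e' \<psi>" by (intro Or.IH) (use Or.prems in simp)
  ultimately show ?case by simp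
next
  case (Ex i \<phi>)
  have "sat S (e(i := a)) \<phi> = sat S (e'(i := a)) \<phi>" for a
    by (intro Ex.IH) (use Ex.prems in simp)
  then show ?case by simp
next
  case (All i \<phi>)
  have "sat S (e(i := a)) \<phi> = sat S (e'(i := a)) \<phi>" for a
    by (intro All.IH) (use All.prems in simp)
  then show ?case by simp
qed

text \<open>If there is at least one variable, a separating sentence with at most \<open>r\<close> quantifiers can be
  padded with dummy quantifiers to one with exactly \<open>r\<close>. For \<open>k = 0\<close> only the bound \<open>\<le> r\<close> makes
  sense.\<close>

lemma separating_at_most_iff_exactly:
  assumes "1 \<le> k" and "\<forall>S\<in>\<A> \<union> \<B>. is_struct \<tau> S"
  shows "(\<exists>\<phi>. is_sentence \<tau> k \<phi> \<and> num_quants \<phi> \<le> r \<and> separating \<A> \<B> \<phi>) \<longleftrightarrow>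
         (\<exists>\<phi>. is_sentence \<tau> k \<phi> \<and> num_quants \<phi> = r \<and> separating \<A> \<B> \<phi>)"
proof
  assume "\<exists>\<phi>. is_sentence \<tau> k \<phi> \<and> num_quants \<phi> \<le> r \<and> separating \<A> \<B> \<phi>"
  then obtain \<phi> where \<phi>: "is_sentence \<tau> k \<phi>" "num_quants \<phi> \<le> r" "separating \<A> \<B> \<phi>" by blast
  have pad: "\<exists>\<psi>. is_sentence \<tau> k \<psi> \<and> num_quants \<psi> = num_quants \<phi> + n \<and> separating \<A> \<B> \<psi>" for n
  proof (induction n)
    case 0
    show ?case using \<phi> by auto
  next
    case (Suc n)
    then obtain \<psi> where \<psi>: "is_sentence \<tau> k \<psi>" "num_quants \<psi> = num_quants \<phi> + n"
      "separating \<A> \<B> \<psi>" by blast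
    have upd: "sat S (e(1 := a)) \<psi> = sat S e \<psi>" for S :: "('a, 'b, 'c) struct" and e a
      using \<psi>(1) by (intro sat_cong) (auto simp: is_sentence_def)
    have "models S (Ex 1 \<psi>) = models S \<psi>" if "S \<in> \<A> \<union> \<B>" for S
    proof -
      have "univ S \<noteq> {}" using assms(2) that by (auto simp: is_struct_def)
      then show ?thesis unfolding models_def sat.simps upd by blast
    qed
    then have "separating \<A> \<B> (Ex 1 \<psi>)" using \<psi>(3) by (auto simp: separating_def)
    moreover have "is_sentence \<tau> k (Ex 1 \<psi>)" using \<psi>(1) assms(1) by (auto simp: is_sentence_def)
    ultimately show ?case using \<psi>(2) by (intro exI[of _ "Ex 1 \<psi>"]) auto
  qed
  show "\<exists>\<phi>. is_sentence \<tau> k \<phi> \<and> num_quants \<phi> = r \<and> separating \<A> \<B> \<phi>"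
    using pad[of "r - num_quants \<phi>"] \<phi>(2) by auto
qed auto

end

theory Submission
  imports Defs
begin

text \<open>A separating formula tells Spoiler how to play: an atom closes a leaf, a negation is a swap,
  a disjunction (conjunction) splits the left (right) side, and an existential (universal) quantifier
  is a pebble move on the left (right). Each move replaces a leaf by leaves whose formulas have
  smaller total size, so the sum over all open leaves of the least size of a separating formula
  bounds the length of the play. Conversely, if no formula separates a node, then Duplicator, by
  making one copy of each structure for every possible position of the pebble, keeps some
  open leaf inseparable forever. Free variables are controlled by the set \<open>D\<close> of colours
  present at a node; it has to be carried along explicitly because it cannot be read off a node
  with no structures.\<close>

section \<open>Open leaves of game trees\<close>

fun opens :: "'n gtree \<Rightarrow> 'n list" where
  "opens (Open X) = [X]"
| "opens (Closed X) = []"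
| "opens (Branch X ts) = concat (map opens ts)"

lemma opens_eq_Nil_iff: "opens T = [] \<longleftrightarrow> all_closed T"
  by (induction T) auto

lemma open_leaf_exists: "\<not> all_closed T \<Longrightarrow> \<exists>p X. open_leaf T p = Some X"
proof (induction T)
  case (Open X)
  have "open_leaf (Open X) [] = Some X" by simp
  then show ?case by blast
next
  case (Branch X ts)
  then obtain i where i: "i < length ts" "\<not> all_closed (ts ! i)"
    by (auto simp: in_set_conv_nth)
  then obtain p Y where "open_leaf (ts ! i) p = Some Y" using Branch.IH nth_mem by blast
  then have "open_leaf (Branch X ts) (i # p) = Some Y" using i by simp
  then show ?case by blast
qed simp

lemma opens_graft:
  "open_leaf T p = Some X \<Longrightarrow>
     \<exists>xs ys. opens T = xs @ X # ys \<and> (\<forall>U. opens (graft T p U) = xs @ opens U @ ys)"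
proof (induction T p rule: open_leaf.induct)
  case (1 Y)
  then show ?case by (intro exI[of _ "[]"]) simp
next
  case (2 Y ts i p)
  then have i: "i < length ts" and "open_leaf (ts ! i) p = Some X"
    by (auto split: if_splits)
  with 2 obtain xs ys where xs: "opens (ts ! i) = xs @ X # ys"
    "\<forall>U. opens (graft (ts ! i) p U) = xs @ opens U @ ys" by blast
  have ts: "ts = take i ts @ ts ! i # drop (Suc i) ts" using i by (rule id_take_nth_drop)
  have "opens (Branch Y ts) =
      concat (map opens (take i ts)) @ opens (ts ! i) @ concat (map opens (drop (Suc i) ts))"
    by (subst ts) simp
  moreover have "opens (graft (Branch Y ts) (i # p) U) = concat (map opens (take i ts)) @
      opens (graft (ts ! i) p U) @ concat (map opens (drop (Suc i) ts))" for U
    using i by (simp add: upd_conv_take_nth_drop)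
  ultimately show ?case using xs
    by (intro exI[of _ "concat (map opens (take i ts)) @ xs"]
        exI[of _ "ys @ concat (map opens (drop (Suc i) ts))"]) simp
qed auto

section \<open>Separation of game nodes\<close>

definition pebbled_sat :: "('f, 'r, 'a) pebbled \<Rightarrow> ('f, 'r) fm \<Rightarrow> bool" where
  "pebbled_sat P \<phi> \<longleftrightarrow> sat (fst P) (\<lambda>i. the (snd P i)) \<phi>"

lemma pebbled_sat_simps [simp]:
  "pebbled_sat P (Atom a) \<longleftrightarrow> peb_sat P a"
  "pebbled_sat P (Neg \<phi>) \<longleftrightarrow> \<not> pebbled_sat P \<phi>"
  "pebbled_sat P (And \<phi> \<psi>) \<longleftrightarrow> pebbled_sat P \<phi> \<and> pebbled_sat P \<psi>"
  "pebbled_sat P (Or \<phi> \<psi>) \<longleftrightarrow> pebbled_sat P \<phi> \<or> pebbled_sat P \<psi>"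
  by (auto simp: pebbled_sat_def peb_sat_def)

lemma pebbled_sat_place:
  "pebbled_sat (place i a P) \<phi> \<longleftrightarrow> sat (fst P) ((\<lambda>i. the (snd P i))(i := a)) \<phi>"
proof -
  have "(\<lambda>j. the (((snd P)(i \<mapsto> a)) j)) = (\<lambda>j. the (snd P j))(i := a)" by auto
  then show ?thesis by (simp add: pebbled_sat_def place_def)
qed

lemma pebbled_sat_quant [simp]:
  "pebbled_sat P (Ex i \<phi>) \<longleftrightarrow> (\<exists>a\<in>univ (fst P). pebbled_sat (place i a P) \<phi>)"
  "pebbled_sat P (All i \<phi>) \<longleftrightarrow> (\<forall>a\<in>univ (fst P). pebbled_sat (place i a P) \<phi>)"
  by (simp_all add: pebbled_sat_place) (simp_all add: pebbled_sat_def)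

lemma place_simps [simp]:
  "fst (place i a P) = fst P"
  "dom (snd (place i a P)) = insert i (dom (snd P))"
  by (auto simp: place_def)

lemma ball_place_each [simp]:
  "(\<forall>P\<in>place_each i f L. Q P) \<longleftrightarrow> (\<forall>P\<in>L. Q (place i (f P) P))"
  by (simp add: place_each_def)

lemma ball_dup_replies:
  assumes "L' \<in> dup_replies i L" and "\<And>P a. P \<in> L \<Longrightarrow> a \<in> univ (fst P) \<Longrightarrow> Q (place i a P)"
  shows "\<forall>P\<in>L'. Q P"
  using assms unfolding dup_replies_def by blast

fun separates_node ::
  "('f, 'r) vocab \<Rightarrow> nat \<Rightarrow> ('f, 'r) fm \<Rightarrow> ('f, 'r, 'a) gnode \<Rightarrow> bool" where
  "separates_node \<tau> k \<phi> (L, R, r) \<longleftrightarrow>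
     fm_ok \<tau> \<phi> \<and> all_vars \<phi> \<subseteq> {1..k} \<and> num_quants \<phi> \<le> r \<and>
     (\<forall>P\<in>L. free_vars \<phi> \<subseteq> dom (snd P) \<and> pebbled_sat P \<phi>) \<and>
     (\<forall>P\<in>R. free_vars \<phi> \<subseteq> dom (snd P) \<and> \<not> pebbled_sat P \<phi>)"

lemma separates_node_unpebbled_iff:
  assumes "\<forall>S\<in>\<A> \<union> \<B>. is_struct \<tau> S" and "free_vars \<phi> = {}"
  shows "separates_node \<tau> k \<phi> (unpebbled ` \<A>, unpebbled ` \<B>, r) \<longleftrightarrow>
         is_sentence \<tau> k \<phi> \<and> num_quants \<phi> \<le> r \<and> separating \<A> \<B> \<phi>"
proof -
  have models: "models S \<phi> \<longleftrightarrow> pebbled_sat (unpebbled S) \<phi>" if "S \<in> \<A> \<union> \<B>" for S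
  proof -
    have sat: "sat S e \<phi> \<longleftrightarrow> pebbled_sat (unpebbled S) \<phi>" for e
      unfolding pebbled_sat_def unpebbled_def fst_conv
      by (intro sat_cong) (use assms(2) in simp)
    have "univ S \<noteq> {}" using assms(1) that unfolding is_struct_def by blast
    then obtain a where "a \<in> univ S" by blast
    then have "range (\<lambda>_ :: nat. a) \<subseteq> univ S" by auto
    with sat show ?thesis unfolding models_def by metis
  qed
  have "separating \<A> \<B> \<phi> \<longleftrightarrow>
      (\<forall>S\<in>\<A>. pebbled_sat (unpebbled S) \<phi>) \<and> (\<forall>S\<in>\<B>. \<not> pebbled_sat (unpebbled S) \<phi>)"
    unfolding separating_def using models by (intro arg_cong2[of _ _ _ _ "(\<and>)"] ball_cong) auto
  then show ?thesis using assms(2) by (simp add: is_sentence_def conj_ac)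
qed

section \<open>Spoiler follows a separating formula\<close>

definition separable :: "('f, 'r) vocab \<Rightarrow> nat \<Rightarrow> ('f, 'r, 'a) gnode \<Rightarrow> bool" where
  "separable \<tau> k X \<longleftrightarrow> (\<exists>\<phi>. separates_node \<tau> k \<phi> X)"

definition cost :: "('f, 'r) vocab \<Rightarrow> nat \<Rightarrow> ('f, 'r, 'a) gnode \<Rightarrow> nat" where
  "cost \<tau> k X = (LEAST n. \<exists>\<phi>. separates_node \<tau> k \<phi> X \<and> size \<phi> = n)"

abbreviation total_cost :: "('f, 'r) vocab \<Rightarrow> nat \<Rightarrow> ('f, 'r, 'a) gnode gtree \<Rightarrow> nat" where
  "total_cost \<tau> k T \<equiv> sum_list (map (cost \<tau> k) (opens T))"

lemma cost_le_size: "separates_node \<tau> k \<phi> X \<Longrightarrow> cost \<tau> k X \<le> size \<phi>"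
  unfolding cost_def by (rule Least_le) blast

lemma separable_cost_attained:
  assumes "separable \<tau> k X"
  obtains \<phi> where "separates_node \<tau> k \<phi> X" and "size \<phi> = cost \<tau> k X"
proof -
  have "\<exists>n \<phi>. separates_node \<tau> k \<phi> X \<and> size \<phi> = n" using assms by (auto simp: separable_def)
  from LeastI_ex[OF this] show thesis using that unfolding cost_def by blast
qed

definition good_move ::
  "('f, 'r) vocab \<Rightarrow> nat \<Rightarrow> ('f, 'r, 'a) gnode \<Rightarrow> nat \<Rightarrow> ('f, 'r, 'a) act \<Rightarrow> bool" where
  "good_move \<tau> k X n a \<longleftrightarrow> legal \<tau> k X a \<and>
     (\<forall>U\<in>results X a. (\<forall>Y\<in>set (opens U). separable \<tau> k Y) \<and> total_cost \<tau> k U < n)"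

lemma good_move_exists:
  assumes "separates_node \<tau> k \<phi> X"
  shows "\<exists>a. good_move \<tau> k X (size \<phi>) a"
proof -
  obtain L R r where X: "X = (L, R, r)" by (cases X)
  have leaf: "separable \<tau> k Y \<and> cost \<tau> k Y \<le> size \<psi>" if "separates_node \<tau> k \<psi> Y"
    for \<psi> and Y :: "('a, 'b, 'c) gnode"
    using that by (auto simp: separable_def intro: cost_le_size)
  show ?thesis
  proof (cases \<phi>)
    case (Atom a)
    then have "good_move \<tau> k X (size \<phi>) (Close a)"
      using assms by (auto simp: X good_move_def)
    then show ?thesis ..
  next
    case (Neg \<psi>)
    then have "separates_node \<tau> k \<psi> (R, L, r)" using assms by (auto simp: X)
    from leaf[OF this] Neg have "good_move \<tau> k X (size \<phi>) Swap"
      by (simp add: X good_move_def)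
    then show ?thesis ..
  next
    case (And \<psi> \<chi>)
    let ?R1 = "{P\<in>R. \<not> pebbled_sat P \<psi>}" and ?R2 = "{P\<in>R. pebbled_sat P \<psi>}"
    let ?r1 = "num_quants \<psi>" and ?r2 = "r - num_quants \<psi>"
    have "separates_node \<tau> k \<psi> (L, ?R1, ?r1)" "separates_node \<tau> k \<chi> (L, ?R2, ?r2)"
      using assms And by (auto simp: X)
    from leaf[OF this(1)] leaf[OF this(2)] assms And
    have "good_move \<tau> k X (size \<phi>) (SplitRight ?r1 ?r2 ?R1 ?R2)"
      by (auto simp: X good_move_def)
    then show ?thesis ..
  next
    case (Or \<psi> \<chi>)
    let ?L1 = "{P\<in>L. pebbled_sat P \<psi>}" and ?L2 = "{P\<in>L. \<not> pebbled_sat P \<psi>}"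
    let ?r1 = "num_quants \<psi>" and ?r2 = "r - num_quants \<psi>"
    have "separates_node \<tau> k \<psi> (?L1, R, ?r1)" "separates_node \<tau> k \<chi> (?L2, R, ?r2)"
      using assms Or by (auto simp: X)
    from leaf[OF this(1)] leaf[OF this(2)] assms Or
    have "good_move \<tau> k X (size \<phi>) (SplitLeft ?r1 ?r2 ?L1 ?L2)"
      by (auto simp: X good_move_def)
    then show ?thesis ..
  next
    case (Ex i \<psi>)
    then have "\<forall>P\<in>L. \<exists>a. a \<in> univ (fst P) \<and> pebbled_sat (place i a P) \<psi>"
      using assms by (auto simp: X)
    then obtain f where f: "\<forall>P\<in>L. f P \<in> univ (fst P) \<and> pebbled_sat (place i (f P) P) \<psi>"
      by metis
    have "separates_node \<tau> k \<psi> (place_each i f L, R', r - 1)" if "R' \<in> dup_replies i R" for R'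
    proof -
      have "\<forall>P\<in>R'. free_vars \<psi> \<subseteq> dom (snd P) \<and> \<not> pebbled_sat P \<psi>"
        using that by (rule ball_dup_replies) (use assms Ex in \<open>auto simp: X\<close>)
      then show ?thesis using assms Ex f by (auto simp: X Diff_subset_conv)
    qed
    from leaf[OF this] f assms Ex have "good_move \<tau> k X (size \<phi>) (PebbleLeft i f)"
      by (auto simp: X good_move_def less_Suc_eq_le)
    then show ?thesis ..
  next
    case (All i \<psi>)
    then have "\<forall>P\<in>R. \<exists>a. a \<in> univ (fst P) \<and> \<not> pebbled_sat (place i a P) \<psi>"
      using assms by (auto simp: X)
    then obtain f where f: "\<forall>P\<in>R. f P \<in> univ (fst P) \<and> \<not> pebbled_sat (place i (f P) P) \<psi>"
      by metis
    have "separates_node \<tau> k \<psi> (L', place_each i f R, r - 1)" if "L' \<in> dup_replies i L" for L'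
    proof -
      have "\<forall>P\<in>L'. free_vars \<psi> \<subseteq> dom (snd P) \<and> pebbled_sat P \<psi>"
        using that by (rule ball_dup_replies) (use assms All in \<open>auto simp: X\<close>)
      then show ?thesis using assms All f by (auto simp: X Diff_subset_conv)
    qed
    from leaf[OF this] f assms All have "good_move \<tau> k X (size \<phi>) (PebbleRight i f)"
      by (auto simp: X good_move_def less_Suc_eq_le)
    then show ?thesis ..
  qed
qed

lemma separable_imp_winning_strategy:
  assumes "separable \<tau> k X0"
  shows "\<exists>\<sigma>. winning_strategy \<tau> k (Open X0) \<sigma>"
proof -
  let ?inv = "\<lambda>T :: ('a, 'b, 'c) gnode gtree. \<forall>X\<in>set (opens T). separable \<tau> k X"
  let ?good = "\<lambda>T m. \<forall>T'\<in>successors \<tau> k T m. ?inv T' \<and> total_cost \<tau> k T' < total_cost \<tau> k T"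
  have "\<exists>m. ?good T m" if inv: "?inv T" and not_closed: "\<not> all_closed T" for T
  proof -
    obtain p X where p: "open_leaf T p = Some X" using open_leaf_exists not_closed by blast
    obtain xs ys where xs: "opens T = xs @ X # ys"
      "\<forall>U. opens (graft T p U) = xs @ opens U @ ys" using opens_graft[OF p] by blast
    then have "separable \<tau> k X" using inv by simp
    then obtain a where "good_move \<tau> k X (cost \<tau> k X) a"
      by (metis separable_cost_attained good_move_exists)
    then have "?good T (p, a)"
      using inv p xs by (auto simp: successors_def good_move_def)
    then show ?thesis ..
  qed
  then obtain \<sigma> where \<sigma>: "\<And>T. ?inv T \<Longrightarrow> \<not> all_closed T \<Longrightarrow> ?good T (\<sigma> T)" by metis
  have "\<exists>n. all_closed (\<rho> n)" if play: "consistent_play \<tau> k (Open X0) \<sigma> \<rho>" for \<rho>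
  proof (rule ccontr)
    assume never: "\<nexists>n. all_closed (\<rho> n)"
    have step: "\<rho> (Suc n) \<in> successors \<tau> k (\<rho> n) (\<sigma> (\<rho> n))" for n
      using play by (simp add: consistent_play_def)
    have inv: "?inv (\<rho> n)" for n
    proof (induction n)
      case 0
      then show ?case using play assms by (simp add: consistent_play_def)
    next
      case (Suc n)
      then show ?case using \<sigma> step never by blast
    qed
    have "total_cost \<tau> k (\<rho> (Suc n)) < total_cost \<tau> k (\<rho> n)" for n
      using \<sigma> inv step never by blast
    then show False using wf_no_infinite_down_chainE[OF wf_less, of "\<lambda>n. total_cost \<tau> k (\<rho> n)"]
      by blast
  qed
  then show ?thesis by (auto simp: winning_strategy_def)
qed

section \<open>Duplicator keeps an inseparable leaf\<close>

fun nonempty_univs :: "('f, 'r, 'a) gnode \<Rightarrow> bool" where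
  "nonempty_univs (L, R, r) \<longleftrightarrow> (\<forall>P\<in>L \<union> R. univ (fst P) \<noteq> {})"

fun colours_are :: "nat set \<Rightarrow> ('f, 'r, 'a) gnode \<Rightarrow> bool" where
  "colours_are D (L, R, r) \<longleftrightarrow> (\<forall>P\<in>L \<union> R. dom (snd P) = D)"

definition inseparable :: "('f, 'r) vocab \<Rightarrow> nat \<Rightarrow> ('f, 'r, 'a) gnode \<Rightarrow> bool" where
  "inseparable \<tau> k X \<longleftrightarrow>
     (\<exists>D. colours_are D X \<and> (\<nexists>\<phi>. free_vars \<phi> \<subseteq> D \<and> separates_node \<tau> k \<phi> X))"

lemma separator_if_not_inseparable:
  assumes "\<not> inseparable \<tau> k X" and "colours_are D X"
  obtains \<phi> where "free_vars \<phi> \<subseteq> D" and "separates_node \<tau> k \<phi> X"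
  using assms by (auto simp: inseparable_def)

definition full_reply :: "nat \<Rightarrow> ('f, 'r, 'a) pebbled set \<Rightarrow> ('f, 'r, 'a) pebbled set" where
  "full_reply i L = (\<Union>P\<in>L. (\<lambda>a. place i a P) ` univ (fst P))"

lemma ball_full_reply [simp]:
  "(\<forall>P\<in>full_reply i L. Q P) \<longleftrightarrow> (\<forall>P\<in>L. \<forall>a\<in>univ (fst P). Q (place i a P))"
  by (auto simp: full_reply_def)

lemma full_reply_in_dup_replies:
  "\<forall>P\<in>L. univ (fst P) \<noteq> {} \<Longrightarrow> full_reply i L \<in> dup_replies i L"
  unfolding full_reply_def dup_replies_def
  by (rule CollectI, rule exI[of _ "\<lambda>P. univ (fst P)"]) simp

lemma duplicator_reply_exists:
  assumes "legal \<tau> k X a" and "nonempty_univs X"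
  shows "\<exists>U\<in>results X a. (\<forall>Y\<in>set (opens U). nonempty_univs Y) \<and>
           (inseparable \<tau> k X \<longrightarrow> (\<exists>Y\<in>set (opens U). inseparable \<tau> k Y))"
proof -
  obtain L R r where X: "X = (L, R, r)" by (cases X)
  have ne: "\<forall>P\<in>L. univ (fst P) \<noteq> {}" "\<forall>P\<in>R. univ (fst P) \<noteq> {}"
    using assms(2) by (auto simp: X)
  note replies = full_reply_in_dup_replies[OF ne(1)] full_reply_in_dup_replies[OF ne(2)]
  have insepD: "\<exists>Y\<in>set (opens U). inseparable \<tau> k Y"
    if "inseparable \<tau> k X"
      and "\<And>D. colours_are D X \<Longrightarrow> \<forall>Y\<in>set (opens U). \<not> inseparable \<tau> k Y \<Longrightarrow>
             \<exists>\<phi>. free_vars \<phi> \<subseteq> D \<and> separates_node \<tau> k \<phi> X" for U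
    using that by (auto simp: inseparable_def[of _ _ X])
  show ?thesis
  proof (cases a)
    case (PebbleLeft i f)
    let ?Y = "(place_each i f L, full_reply i R, r - 1)"
    let ?U = "Branch X [Open ?Y]"
    have "?U \<in> results X a" using replies by (auto simp: X PebbleLeft)
    moreover have "nonempty_univs ?Y" using ne by (simp add: ball_Un)
    moreover have "\<exists>\<phi>. free_vars \<phi> \<subseteq> D \<and> separates_node \<tau> k \<phi> X"
      if D: "colours_are D X" and nY: "\<not> inseparable \<tau> k ?Y" for D
    proof -
      have "colours_are (insert i D) ?Y"
        using D by (simp add: X ball_Un)
      then obtain \<phi> where \<phi>: "free_vars \<phi> \<subseteq> insert i D" "separates_node \<tau> k \<phi> ?Y"
        using nY separator_if_not_inseparable by blast
      then have "separates_node \<tau> k (Ex i \<phi>) X"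
        using assms(1) D by (auto simp: X PebbleLeft ball_Un Diff_subset_conv)
      then show ?thesis using \<phi>(1) by (intro exI[of _ "Ex i \<phi>"]) auto
    qed
    ultimately show ?thesis using insepD[of ?U] by (intro bexI[of _ ?U]) auto
  next
    case (PebbleRight i f)
    let ?Y = "(full_reply i L, place_each i f R, r - 1)"
    let ?U = "Branch X [Open ?Y]"
    have "?U \<in> results X a" using replies by (auto simp: X PebbleRight)
    moreover have "nonempty_univs ?Y" using ne by (simp add: ball_Un)
    moreover have "\<exists>\<phi>. free_vars \<phi> \<subseteq> D \<and> separates_node \<tau> k \<phi> X"
      if D: "colours_are D X" and nY: "\<not> inseparable \<tau> k ?Y" for D
    proof -
      have "colours_are (insert i D) ?Y"
        using D by (simp add: X ball_Un)
      then obtain \<phi> where \<phi>: "free_vars \<phi> \<subseteq> insert i D" "separates_node \<tau> k \<phi> ?Y"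
        using nY separator_if_not_inseparable by blast
      then have "separates_node \<tau> k (All i \<phi>) X"
        using assms(1) D by (auto simp: X PebbleRight ball_Un Diff_subset_conv)
      then show ?thesis using \<phi>(1) by (intro exI[of _ "All i \<phi>"]) auto
    qed
    ultimately show ?thesis using insepD[of ?U] by (intro bexI[of _ ?U]) auto
  next
    case (SplitLeft r1 r2 L1 L2)
    let ?Y1 = "(L1, R, r1)" and ?Y2 = "(L2, R, r2)"
    let ?U = "Branch X [Open ?Y1, Open ?Y2]"
    have split: "r = r1 + r2" "L = L1 \<union> L2" using assms(1) by (auto simp: X SplitLeft)
    have "?U \<in> results X a" by (auto simp: X SplitLeft)
    moreover have "nonempty_univs ?Y1" "nonempty_univs ?Y2" using ne split by auto
    moreover have "\<exists>\<phi>. free_vars \<phi> \<subseteq> D \<and> separates_node \<tau> k \<phi> X"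
      if D: "colours_are D X" and nY: "\<not> inseparable \<tau> k ?Y1" "\<not> inseparable \<tau> k ?Y2" for D
    proof -
      have cols: "colours_are D ?Y1" "colours_are D ?Y2" using D split by (auto simp: X)
      obtain \<phi> where \<phi>: "free_vars \<phi> \<subseteq> D" "separates_node \<tau> k \<phi> ?Y1"
        using separator_if_not_inseparable[OF nY(1) cols(1)] .
      obtain \<psi> where \<psi>: "free_vars \<psi> \<subseteq> D" "separates_node \<tau> k \<psi> ?Y2"
        using separator_if_not_inseparable[OF nY(2) cols(2)] .
      have "separates_node \<tau> k (Or \<phi> \<psi>) X" using \<phi> \<psi> D split by (auto simp: X)
      then show ?thesis using \<phi>(1) \<psi>(1) by (intro exI[of _ "Or \<phi> \<psi>"]) auto
    qed
    ultimately show ?thesis using insepD[of ?U] by (intro bexI[of _ ?U]) auto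
  next
    case (SplitRight r1 r2 R1 R2)
    let ?Y1 = "(L, R1, r1)" and ?Y2 = "(L, R2, r2)"
    let ?U = "Branch X [Open ?Y1, Open ?Y2]"
    have split: "r = r1 + r2" "R = R1 \<union> R2" using assms(1) by (auto simp: X SplitRight)
    have "?U \<in> results X a" by (auto simp: X SplitRight)
    moreover have "nonempty_univs ?Y1" "nonempty_univs ?Y2" using ne split by auto
    moreover have "\<exists>\<phi>. free_vars \<phi> \<subseteq> D \<and> separates_node \<tau> k \<phi> X"
      if D: "colours_are D X" and nY: "\<not> inseparable \<tau> k ?Y1" "\<not> inseparable \<tau> k ?Y2" for D
    proof -
      have cols: "colours_are D ?Y1" "colours_are D ?Y2" using D split by (auto simp: X)
      obtain \<phi> where \<phi>: "free_vars \<phi> \<subseteq> D" "separates_node \<tau> k \<phi> ?Y1"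
        using separator_if_not_inseparable[OF nY(1) cols(1)] .
      obtain \<psi> where \<psi>: "free_vars \<psi> \<subseteq> D" "separates_node \<tau> k \<psi> ?Y2"
        using separator_if_not_inseparable[OF nY(2) cols(2)] .
      have "separates_node \<tau> k (And \<phi> \<psi>) X" using \<phi> \<psi> D split by (auto simp: X)
      then show ?thesis using \<phi>(1) \<psi>(1) by (intro exI[of _ "And \<phi> \<psi>"]) auto
    qed
    ultimately show ?thesis using insepD[of ?U] by (intro bexI[of _ ?U]) auto
  next
    case Swap
    let ?Y = "(R, L, r)"
    let ?U = "Branch X [Open ?Y]"
    have "?U \<in> results X a" by (auto simp: X Swap)
    moreover have "nonempty_univs ?Y" using ne by auto
    moreover have "\<exists>\<phi>. free_vars \<phi> \<subseteq> D \<and> separates_node \<tau> k \<phi> X"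
      if D: "colours_are D X" and nY: "\<not> inseparable \<tau> k ?Y" for D
    proof -
      have "colours_are D ?Y" using D by (auto simp: X)
      then obtain \<phi> where \<phi>: "free_vars \<phi> \<subseteq> D" "separates_node \<tau> k \<phi> ?Y"
        using nY separator_if_not_inseparable by blast
      then have "separates_node \<tau> k (Neg \<phi>) X" by (auto simp: X)
      then show ?thesis using \<phi>(1) by (intro exI[of _ "Neg \<phi>"]) auto
    qed
    ultimately show ?thesis using insepD[of ?U] by (intro bexI[of _ ?U]) auto
  next
    case (Close b)
    let ?U = "Closed X"
    have "?U \<in> results X a" by (auto simp: X Close)
    moreover have "\<exists>\<phi>. free_vars \<phi> \<subseteq> D \<and> separates_node \<tau> k \<phi> X"
      if D: "colours_are D X" for D
    proof (cases "L \<union> R = {}")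
      case True
      \<comment> \<open>The closing atom may mention colours outside \<open>D\<close> here.\<close>
      then show ?thesis by (intro exI[of _ "Atom Tru"]) (simp add: X)
    next
      case False
      then show ?thesis using assms(1) D
        by (intro exI[of _ "Atom b"]) (auto simp: X Close)
    qed
    ultimately show ?thesis using insepD[of ?U] by (intro bexI[of _ ?U]) auto
  qed
qed

lemma inseparable_imp_no_winning_strategy:
  assumes "inseparable \<tau> k X0" and "nonempty_univs X0"
  shows "\<not> winning_strategy \<tau> k (Open X0) \<sigma>"
proof -
  let ?inv = "\<lambda>T. (\<forall>X\<in>set (opens T). nonempty_univs X) \<and> (\<exists>X\<in>set (opens T). inseparable \<tau> k X)"
  have step: "\<exists>T'\<in>successors \<tau> k T m. ?inv T'" if inv: "?inv T" for T m
  proof (cases "\<exists>X. open_leaf T (fst m) = Some X \<and> legal \<tau> k X (snd m)")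
    case True
    then obtain X where X: "open_leaf T (fst m) = Some X" "legal \<tau> k X (snd m)" by blast
    obtain xs ys where xs: "opens T = xs @ X # ys"
      "\<forall>U. opens (graft T (fst m) U) = xs @ opens U @ ys" using opens_graft[OF X(1)] by blast
    have "nonempty_univs X" using inv xs(1) by simp
    then obtain U where U: "U \<in> results X (snd m)" "\<forall>Y\<in>set (opens U). nonempty_univs Y"
      "inseparable \<tau> k X \<longrightarrow> (\<exists>Y\<in>set (opens U). inseparable \<tau> k Y)"
      using duplicator_reply_exists[OF X(2)] by blast
    have "graft T (fst m) U \<in> successors \<tau> k T m"
      using X U(1) by (simp add: successors_def split_beta)
    moreover have "?inv (graft T (fst m) U)" using inv xs U(2,3) by auto
    ultimately show ?thesis by blast
  next
    case False
    then have "T \<in> successors \<tau> k T m"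
      by (auto simp: successors_def split_beta split: option.splits)
    with inv show ?thesis by blast
  qed
  have "\<exists>\<rho>. \<forall>n. (?inv (\<rho> n) \<and> (n = 0 \<longrightarrow> \<rho> n = Open X0)) \<and>
      \<rho> (Suc n) \<in> successors \<tau> k (\<rho> n) (\<sigma> (\<rho> n))"
  proof (rule dependent_nat_choice)
    show "\<exists>T. ?inv T \<and> (0 = 0 \<longrightarrow> T = Open X0)"
      using assms by (intro exI[of _ "Open X0"]) simp
  next
    fix T and n :: nat
    assume "?inv T \<and> (n = 0 \<longrightarrow> T = Open X0)"
    then show "\<exists>T'. (?inv T' \<and> (Suc n = 0 \<longrightarrow> T' = Open X0)) \<and> T' \<in> successors \<tau> k T (\<sigma> T)"
      using step[of T "\<sigma> T"] by auto
  qed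
  then obtain \<rho> where \<rho>: "\<And>n. ?inv (\<rho> n)" "\<rho> 0 = Open X0"
    "\<And>n. \<rho> (Suc n) \<in> successors \<tau> k (\<rho> n) (\<sigma> (\<rho> n))" by auto
  then have "consistent_play \<tau> k (Open X0) \<sigma> \<rho>" by (simp add: consistent_play_def)
  moreover have "\<not> all_closed (\<rho> n)" for n
    using \<rho>(1)[of n] by (auto simp flip: opens_eq_Nil_iff)
  ultimately show ?thesis by (auto simp: winning_strategy_def)
qed

theorem theorem5p4:
  fixes \<tau> :: "('f, 'r) vocab"
    and \<A> \<B> :: "('f, 'r, 'a) struct set"
    and r k :: nat
  assumes "\<forall>S\<in>\<A> \<union> \<B>. is_struct \<tau> S"
  shows "spoiler_wins_QVT \<tau> r k \<A> \<B> \<longleftrightarrow>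
         (\<exists>\<phi>. is_sentence \<tau> k \<phi> \<and> num_quants \<phi> \<le> r \<and> separating \<A> \<B> \<phi>)"
proof
  let ?X = "(unpebbled ` \<A>, unpebbled ` \<B>, r)"
  have colours: "colours_are {} ?X" by (auto simp: unpebbled_def)
  have "nonempty_univs ?X" using assms by (auto simp: unpebbled_def is_struct_def)
  moreover assume "spoiler_wins_QVT \<tau> r k \<A> \<B>"
  ultimately have "\<not> inseparable \<tau> k ?X"
    unfolding spoiler_wins_QVT_def using inseparable_imp_no_winning_strategy by blast
  from separator_if_not_inseparable[OF this colours]
  obtain \<phi> where "free_vars \<phi> \<subseteq> {}" "separates_node \<tau> k \<phi> ?X" .
  then show "\<exists>\<phi>. is_sentence \<tau> k \<phi> \<and> num_quants \<phi> \<le> r \<and> separating \<A> \<B> \<phi>"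
    using separates_node_unpebbled_iff[OF assms] by blast
next
  assume "\<exists>\<phi>. is_sentence \<tau> k \<phi> \<and> num_quants \<phi> \<le> r \<and> separating \<A> \<B> \<phi>"
  then have "separable \<tau> k (unpebbled ` \<A>, unpebbled ` \<B>, r)"
    unfolding separable_def using separates_node_unpebbled_iff[OF assms]
    by (metis is_sentence_def)
  then show "spoiler_wins_QVT \<tau> r k \<A> \<B>"
    unfolding spoiler_wins_QVT_def by (rule separable_imp_winning_strategy)
qed

end
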